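(* For every finite simple graph $G$ we have $A_b(G)\leq m_a(G)$.
   Context: A (proper) $k$-coloring of $G$ is a map $c:V(G)\to[k]$ with adjacent vertices colored differently, all $k$ colors used; $V_i=c^{-1}(i)$. A coloring is acyclic if $G[V_i\cup V_j]$ is a forest for all $i,j$. A vertex $v$ is a b-vertex if the colors on $v$ and its neighbors are all $k$ colors. A recoloring step applied to $c$ and a color $i$ having no b-vertex recolors every $v\in V_i$ with a color not appearing on $v$ or its neighbors, producing a $(k-1)$-coloring; if both colorings are acyclic it is an acyclic recoloring step. $A_b(G)$ is the maximum number of colors of an acyclic coloring of $G$ to which no acyclic recoloring step can be applied. Acyclic degree: for $v\in V(G)$, a weak partition of $N_G(v)$ is a partition $P=\{A_0^P,A_1^P,\dots,A_k^P\}$ ($k\geq 0$) of $N_G(v)$ into disjoint sets with $|A_0^P|\geq 0$ (possibly empty) and $|A_t^P|\geq 2$ for $t\in[k]$; let $\mathcal{P}(v)$ be the family of all of them, so $|P|-1=k$. Paths of even length (odd number of vertices) $x_1x_2\cdots x_{2r+1}$ are called even-vertex internally (EVI) disjoint if no vertex lies in an even position ($x_2,x_4,\dots,x_{2r}$) of two different such paths (they may share vertices in odd positions). ${\rm elp}_G(v,P)$ is the maximum number of pairwise EVI disjoint paths not containing $v$, each of even length with its two (distinct) end vertices both in the same set $A_t^P$ for some $t\in[k]$. The acyclic degree is $d_G^a(v)=\max_{P\in\mathcal{P}(v)}\big(|A_0^P|+(|P|-1)+{\rm elp}_G(v,P)\big)$. Ordering the vertices $v_1,\dots,v_{n_G}$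 of $G$ by non-increasing acyclic degree, $m_a(G)=\max\{i: d_G^a(v_i)\geq i-1\}$. *)

theory Defs
  imports "HOL-Library.Multiset" "HOL-Library.Disjoint_Sets"
begin

definition fin_simple_graph :: "'a set \<Rightarrow> 'a set set \<Rightarrow> bool" where
  "fin_simple_graph V E \<longleftrightarrow> finite V \<and> (\<forall>e\<in>E. e \<subseteq> V \<and> card e = 2)"

definition nbhd :: "'a set \<Rightarrow> 'a set set \<Rightarrow> 'a \<Rightarrow> 'a set" where
  "nbhd V E v = {u \<in> V. {u, v} \<in> E}"

text \<open>Paths and cycles are given by their sequences of vertices.\<close>

definition is_path :: "'a set \<Rightarrow> 'a set set \<Rightarrow> 'a list \<Rightarrow> bool" where
  "is_path V E xs \<longleftrightarrow>
     xs \<noteq> [] \<and> distinct xs \<and> set xs \<subseteq> V \<and> successively (\<lambda>x y. {x, y} \<in> E) xs"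

definition is_cycle :: "'a set \<Rightarrow> 'a set set \<Rightarrow> 'a list \<Rightarrow> bool" where
  "is_cycle V E xs \<longleftrightarrow> is_path V E xs \<and> 3 \<le> length xs \<and> {last xs, hd xs} \<in> E"

definition is_forest :: "'a set \<Rightarrow> 'a set set \<Rightarrow> bool" where
  "is_forest V E \<longleftrightarrow> (\<nexists>xs. is_cycle V E xs)"

definition induced_edges :: "'a set set \<Rightarrow> 'a set \<Rightarrow> 'a set set" where
  "induced_edges E W = {e \<in> E. e \<subseteq> W}"

definition color_class :: "'a set \<Rightarrow> ('a \<Rightarrow> nat) \<Rightarrow> nat \<Rightarrow> 'a set" where
  "color_class V c i = {v \<in> V. c v = i}"

text \<open>
  A \<open>k\<close>-coloring has color set \<open>{1..k}\<close>. The color set \<open>C\<close> is kept general because a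
  recoloring step that removes color \<open>i\<close> yields a coloring with color set \<open>{1..k} - {i}\<close>.
\<close>

definition proper_coloring :: "'a set \<Rightarrow> 'a set set \<Rightarrow> nat set \<Rightarrow> ('a \<Rightarrow> nat) \<Rightarrow> bool" where
  "proper_coloring V E C c \<longleftrightarrow>
     c ` V = C \<and> (\<forall>u\<in>V. \<forall>v\<in>V. {u, v} \<in> E \<longrightarrow> c u \<noteq> c v)"

definition acyclic_coloring :: "'a set \<Rightarrow> 'a set set \<Rightarrow> nat set \<Rightarrow> ('a \<Rightarrow> nat) \<Rightarrow> bool" where
  "acyclic_coloring V E C c \<longleftrightarrow>
     proper_coloring V E C c \<and>
     (\<forall>i\<in>C. \<forall>j\<in>C. is_forest (color_class V c i \<union> color_class V c j)
        (induced_edges E (color_class V c i \<union> color_class V c j)))"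

definition b_vertex :: "'a set \<Rightarrow> 'a set set \<Rightarrow> nat set \<Rightarrow> ('a \<Rightarrow> nat) \<Rightarrow> 'a \<Rightarrow> bool" where
  "b_vertex V E C c v \<longleftrightarrow> v \<in> V \<and> c ` insert v (nbhd V E v) = C"

definition recoloring_step ::
  "'a set \<Rightarrow> 'a set set \<Rightarrow> nat set \<Rightarrow> ('a \<Rightarrow> nat) \<Rightarrow> nat \<Rightarrow> ('a \<Rightarrow> nat) \<Rightarrow> bool" where
  "recoloring_step V E C c i c' \<longleftrightarrow>
     i \<in> C \<and> (\<forall>v\<in>color_class V c i. \<not> b_vertex V E C c v) \<and>
     (\<forall>v\<in>color_class V c i. c' v \<in> C - c ` insert v (nbhd V E v)) \<and>
     (\<forall>v\<in>V - color_class V c i. c' v = c v)"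

definition acyclic_recoloring_step ::
  "'a set \<Rightarrow> 'a set set \<Rightarrow> nat set \<Rightarrow> ('a \<Rightarrow> nat) \<Rightarrow> nat \<Rightarrow> ('a \<Rightarrow> nat) \<Rightarrow> bool" where
  "acyclic_recoloring_step V E C c i c' \<longleftrightarrow>
     recoloring_step V E C c i c' \<and>
     acyclic_coloring V E C c \<and> acyclic_coloring V E (C - {i}) c'"

definition A_b :: "'a set \<Rightarrow> 'a set set \<Rightarrow> nat" where
  "A_b V E = Max {k. \<exists>c. acyclic_coloring V E {1..k} c \<and>
                        (\<nexists>i c'. acyclic_recoloring_step V E {1..k} c i c')}"

text \<open>The weak partition \<open>{A 0, A 1, \<dots>, A k}\<close> is encoded by \<open>k\<close> and the indexed family \<open>A\<close>.\<close>

definition weak_partition ::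
  "'a set \<Rightarrow> 'a set set \<Rightarrow> 'a \<Rightarrow> nat \<Rightarrow> (nat \<Rightarrow> 'a set) \<Rightarrow> bool" where
  "weak_partition V E v k A \<longleftrightarrow>
     (\<Union>t\<le>k. A t) = nbhd V E v \<and> disjoint_family_on A {..k} \<and> (\<forall>t\<in>{1..k}. 2 \<le> card (A t))"

text \<open>
  Even positions of \<open>x\<^sub>1 x\<^sub>2 \<dots>\<close> are counted from 1, hence are the odd indices of the list.
\<close>

definition even_pos_verts :: "'a list \<Rightarrow> 'a set" where
  "even_pos_verts xs = {xs ! i | i. i < length xs \<and> odd i}"

definition EVI_disjoint :: "'a list set \<Rightarrow> bool" where
  "EVI_disjoint F \<longleftrightarrow> disjoint_family_on even_pos_verts F"

text \<open>
  A path of even length has an odd number of vertices. As the ends are distinct, every path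
  counted below has a vertex in an even position, so a path and its reversal, which are
  different lists, never both belong to an EVI disjoint family.
\<close>

definition elp_path ::
  "'a set \<Rightarrow> 'a set set \<Rightarrow> 'a \<Rightarrow> nat \<Rightarrow> (nat \<Rightarrow> 'a set) \<Rightarrow> 'a list \<Rightarrow> bool" where
  "elp_path V E v k A xs \<longleftrightarrow>
     is_path V E xs \<and> v \<notin> set xs \<and> odd (length xs) \<and> hd xs \<noteq> last xs \<and>
     (\<exists>t\<in>{1..k}. hd xs \<in> A t \<and> last xs \<in> A t)"

definition elp :: "'a set \<Rightarrow> 'a set set \<Rightarrow> 'a \<Rightarrow> nat \<Rightarrow> (nat \<Rightarrow> 'a set) \<Rightarrow> nat" where
  "elp V E v k A = Max {card F | F. (\<forall>xs\<in>F. elp_path V E v k A xs) \<and> EVI_disjoint F}"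

definition acyclic_degree :: "'a set \<Rightarrow> 'a set set \<Rightarrow> 'a \<Rightarrow> nat" where
  "acyclic_degree V E v =
     Max {card (A 0) + k + elp V E v k A | k A. weak_partition V E v k A}"

definition acyclic_degree_seq :: "'a set \<Rightarrow> 'a set set \<Rightarrow> nat list" where
  "acyclic_degree_seq V E =
     rev (sorted_list_of_multiset (image_mset (acyclic_degree V E) (mset_set V)))"

text \<open>
  The element 0 only matters for the graph without vertices, where it fixes \<open>m_a = 0\<close>;
  otherwise \<open>i = 1\<close> belongs to the second set.
\<close>

definition m_a :: "'a set \<Rightarrow> 'a set set \<Rightarrow> nat" where
  "m_a V E = Max ({0} \<union> {i \<in> {1..card V}. i - 1 \<le> acyclic_degree_seq V E ! (i - 1)})"

lemma acyclic_degree_seq_ordering: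
  assumes "distinct vs" "set vs = V"
    and "sorted_wrt (\<lambda>u v. acyclic_degree V E v \<le> acyclic_degree V E u) vs"
  shows "acyclic_degree_seq V E = map (acyclic_degree V E) vs"
proof -
  let ?d = "acyclic_degree V E"
  have "sorted (rev (map ?d vs))"
    using assms(3) by (simp add: sorted_wrt_rev sorted_wrt_map)
  moreover have "mset (rev (map ?d vs)) = image_mset ?d (mset_set V)"
    using assms(1,2) by (metis mset_map mset_rev mset_set_set)
  ultimately have "sorted_list_of_multiset (image_mset ?d (mset_set V)) = rev (map ?d vs)"
    by (metis sorted_list_of_multiset_mset sorted_sort_id)
  then show ?thesis
    by (simp add: acyclic_degree_seq_def)
qed

lemma m_a_ordering:
  assumes "distinct vs" "set vs = V"
    and "sorted_wrt (\<lambda>u v. acyclic_degree V E v \<le> acyclic_degree V E u) vs"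
  shows "m_a V E =
     Max ({0} \<union> {i \<in> {1..length vs}. i - 1 \<le> acyclic_degree V E (vs ! (i - 1))})"
proof -
  have "card V = length vs"
    using assms(1,2) distinct_card by blast
  then have "{i \<in> {1..card V}. i - 1 \<le> acyclic_degree_seq V E ! (i - 1)} =
    {i \<in> {1..length vs}. i - 1 \<le> acyclic_degree V E (vs ! (i - 1))}"
    by (auto simp: acyclic_degree_seq_ordering[OF assms])
  then show ?thesis
    by (simp only: m_a_def)
qed

end

theory Submission
  imports Defs
begin

text \<open>
  Let \<open>c\<close> be an acyclic \<open>k\<close>-coloring, and let \<open>i\<close> be a color all of whose vertices have acyclic
  degree less than \<open>k - 1\<close>. The vertices of color \<open>i\<close> can then be recolored one at a time without
  creating a bicolored cycle: if every color \<open>j\<close> missing on \<open>v\<close> and its neighbors were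
  blocked by a bicolored cycle through \<open>v\<close>, then deleting \<open>v\<close> from these cycles leaves paths of even
  length between equally colored neighbors of \<open>v\<close>. The path for \<open>j\<close> has exactly color \<open>j\<close> in its even
  positions, so the paths are EVI disjoint, and together with the partition of the neighborhood
  by colors they show that the acyclic degree of \<open>v\<close> is at least \<open>k - 1\<close>. Hence an acyclic coloring
  that admits no acyclic recoloring step has in each of its \<open>k\<close> classes a vertex of acyclic degree
  at least \<open>k - 1\<close>.
\<close>

section \<open>Cycles and two-colored paths\<close>

lemma is_cycle_induced_iff:
  assumes "W \<subseteq> V"
  shows "is_cycle W (induced_edges E W) xs \<longleftrightarrow> is_cycle V E xs \<and> set xs \<subseteq> W"
proof -
  have "successively (\<lambda>x y. {x, y} \<in> induced_edges E W) xs \<longleftrightarrow>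
      successively (\<lambda>x y. {x, y} \<in> E) xs" if "set xs \<subseteq> W"
    using that by (intro successively_cong) (auto simp: induced_edges_def)
  moreover have "{last xs, hd xs} \<subseteq> W" if "set xs \<subseteq> W" "xs \<noteq> []"
    using that by auto
  ultimately show ?thesis
    using assms by (auto simp: is_cycle_def is_path_def induced_edges_def)
qed

text \<open>Cycles of an induced subgraph are the cycles of the graph that stay inside it. Letting
  \<open>i\<close> and \<open>j\<close> range over all naturals detaches the cycle condition from
  the color set, which changes while vertices are being recolored.\<close>

lemma acyclic_coloring_iff:
  "acyclic_coloring V E C c \<longleftrightarrow>
     proper_coloring V E C c \<and> (\<forall>xs i j. is_cycle V E xs \<longrightarrow> \<not> c ` set xs \<subseteq> {i, j})"
proof -
  let ?W = "\<lambda>i j. color_class V c i \<union> color_class V c j"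
  have forest: "is_forest (?W i j) (induced_edges E (?W i j)) \<longleftrightarrow>
      (\<forall>xs. is_cycle V E xs \<longrightarrow> \<not> c ` set xs \<subseteq> {i, j})" for i j
  proof -
    have W: "?W i j \<subseteq> V"
      by (auto simp: color_class_def)
    have "set xs \<subseteq> ?W i j \<longleftrightarrow> c ` set xs \<subseteq> {i, j}" if "is_cycle V E xs" for xs
      using that by (auto simp: color_class_def is_cycle_def is_path_def)
    then show ?thesis
      using is_cycle_induced_iff[OF W] by (auto simp: is_forest_def)
  qed
  have "\<exists>i\<in>C. \<exists>j\<in>C. c ` set xs \<subseteq> {i, j}"
    if "proper_coloring V E C c" "is_cycle V E xs" "c ` set xs \<subseteq> {i, j}" for xs i j
  proof -
    have sub: "c ` set xs \<subseteq> C" and ne: "xs \<noteq> []"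
      using that(1,2) by (auto simp: proper_coloring_def is_cycle_def is_path_def)
    have "c (hd xs) \<in> C"
      using sub hd_in_set[OF ne] by blast
    \<comment> \<open>A color outside \<open>C\<close> does not occur on the cycle, so the color of
      \<open>hd xs\<close> can replace it without losing the inclusion.\<close>
    moreover define i' where "i' = (if i \<in> C then i else c (hd xs))"
    moreover define j' where "j' = (if j \<in> C then j else c (hd xs))"
    ultimately have "i' \<in> C" "j' \<in> C" "c ` set xs \<subseteq> {i', j'}"
      using sub that(3) by auto
    then show ?thesis
      by blast
  qed
  then show ?thesis
    unfolding acyclic_coloring_def forest by metis
qed

lemma is_cycle_rotate:
  assumes "is_cycle V E xs" "v \<in> set xs"
  obtains ys where "is_cycle V E (v # ys)" "set (v # ys) = set xs"
proof -
  obtain as bs where xs: "xs = as @ v # bs"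
    using assms(2) by (meson split_list)
  have "is_cycle V E (v # bs @ as)"
    using assms(1) unfolding xs is_cycle_def is_path_def
    by (cases as; cases bs)
      (auto simp: successively_append_iff successively_Cons hd_append split: if_splits)
  then show thesis
    by (rule that) (auto simp: xs)
qed

lemma two_colored_path_alternates:
  assumes "is_path V E ys" "proper_coloring V E C c"
    and "c ` set ys \<subseteq> {j, l}" "c (hd ys) = l" "n < length ys"
  shows "c (ys ! n) = (if even n then l else j)"
  using assms(5)
proof (induction n)
  case 0
  then show ?case
    using assms(4) by (simp add: hd_conv_nth)
next
  case (Suc n)
  have "{ys ! n, ys ! Suc n} \<in> E" "ys ! n \<in> V" "ys ! Suc n \<in> V"
    using assms(1) Suc.prems by (auto simp: is_path_def successively_conv_nth)
  then have "c (ys ! n) \<noteq> c (ys ! Suc n)"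
    using assms(2) by (auto simp: proper_coloring_def)
  moreover have "c (ys ! Suc n) \<in> {j, l}"
    using assms(3) Suc.prems by (meson image_subset_iff nth_mem)
  ultimately show ?case
    using Suc by auto
qed

section \<open>Lower bounds for the acyclic degree\<close>

text \<open>Every admissible family consists of distinct lists over \<open>V\<close>, of which there
  are finitely many. The resulting bound is uniform in \<open>k\<close> and \<open>A\<close>, so it
  also serves for the outer maximum in \<open>acyclic_degree\<close>.\<close>

lemma finite_elp_values:
  assumes "finite V"
  shows "finite {card F | F. (\<forall>xs\<in>F. elp_path V E v k A xs) \<and> EVI_disjoint F}" (is "finite ?S")
    and "elp V E v k A \<le> card {xs. distinct xs \<and> set xs \<subseteq> V}"
proof -
  have fin: "finite {xs. distinct xs \<and> set xs \<subseteq> V}"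
    using finite_subset_distinct[OF assms] by (simp add: conj_commute)
  have bound: "n \<le> card {xs. distinct xs \<and> set xs \<subseteq> V}" if "n \<in> ?S" for n
    using that by (auto intro!: card_mono[OF fin] simp: elp_path_def is_path_def)
  then have "?S \<subseteq> {..card {xs. distinct xs \<and> set xs \<subseteq> V}}"
    by blast
  then show S: "finite ?S"
    by (rule finite_subset) simp
  \<comment> \<open>The empty family makes the set of values nonempty, so its maximum is
    attained.\<close>
  have "card {} \<in> ?S"
    by (auto simp: EVI_disjoint_def disjoint_family_on_def intro!: exI[of _ "{}"])
  then show "elp V E v k A \<le> card {xs. distinct xs \<and> set xs \<subseteq> V}"
    unfolding elp_def by (metis (no_types, lifting) Max_in S bound empty_iff)
qed

text \<open>The blocks \<open>A 1\<close>, ..., \<open>A k\<close> are disjoint, nonempty subsets of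
  \<open>V\<close>. This bounds \<open>k\<close>, which the maximum in \<open>acyclic_degree\<close>
  leaves free.\<close>

lemma weak_partition_number_le:
  assumes "finite V" "weak_partition V E v k A"
  shows "k \<le> card V"
proof -
  have sub: "A t \<subseteq> V" if "t \<le> k" for t
    using assms(2) that by (auto simp: weak_partition_def nbhd_def)
  have dis: "disjoint_family_on A {1..k}"
    using assms(2) by (auto simp: weak_partition_def disjoint_family_on_def)
  have "k = (\<Sum>t\<in>{1..k}. 1)"
    by simp
  also have "\<dots> \<le> (\<Sum>t\<in>{1..k}. card (A t))"
    using assms(2) by (intro sum_mono) (force simp: weak_partition_def)
  also have "\<dots> = card (\<Union>t\<in>{1..k}. A t)"
    using dis sub finite_subset[OF _ assms(1)]
    by (intro card_UN_disjoint[symmetric]) (auto simp: disjoint_family_on_def)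
  also have "\<dots> \<le> card V"
    by (intro card_mono assms(1) UN_least sub) simp
  finally show ?thesis .
qed

lemma acyclic_degree_ge:
  assumes "finite V" "weak_partition V E v k A"
    and "\<And>xs. xs \<in> F \<Longrightarrow> elp_path V E v k A xs" "EVI_disjoint F"
  shows "card (A 0) + k + card F \<le> acyclic_degree V E v"
proof -
  let ?L = "card {xs. distinct xs \<and> set xs \<subseteq> V}"
  let ?S = "{card (A 0) + k + elp V E v k A | k A. weak_partition V E v k A}"
  have "card (A 0) + k + elp V E v k A \<le> card V + card V + ?L"
    if "weak_partition V E v k A" for k A
  proof -
    have "A 0 \<subseteq> V"
      using that by (auto simp: weak_partition_def nbhd_def)
    then show ?thesis
      using weak_partition_number_le[OF assms(1) that] finite_elp_values(2)[OF assms(1)]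
      by (intro add_mono card_mono assms(1))
  qed
  then have "?S \<subseteq> {..card V + card V + ?L}"
    by auto
  then have "finite ?S"
    by (rule finite_subset) simp
  then have "card (A 0) + k + elp V E v k A \<le> acyclic_degree V E v"
    unfolding acyclic_degree_def using assms(2) by (intro Max_ge) auto
  moreover have "card F \<le> elp V E v k A"
    unfolding elp_def using assms(3,4) by (intro Max_ge finite_elp_values(1) assms(1)) auto
  ultimately show ?thesis
    by linarith
qed

text \<open>Neighbors whose color is unique in the neighborhood go to \<open>A 0\<close>; each color
  that is repeated there forms one further block. Thus \<open>card (A 0) + k\<close> counts every
  color of the neighborhood exactly once.\<close>

lemma weak_partition_by_colors:
  assumes "finite V"
  obtains k A where "weak_partition V E v k A" "card (A 0) + k = card (c ` nbhd V E v)"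
    and "\<And>x y. x \<in> nbhd V E v \<Longrightarrow> y \<in> nbhd V E v \<Longrightarrow> x \<noteq> y \<Longrightarrow> c x = c y \<Longrightarrow>
      \<exists>t\<in>{1..k}. x \<in> A t \<and> y \<in> A t"
proof -
  let ?N = "nbhd V E v"
  let ?cls = "\<lambda>l. {x \<in> ?N. c x = l}"
  define M where "M = {l \<in> c ` ?N. 2 \<le> card (?cls l)}"
  have finN: "finite ?N"
    using assms by (simp add: nbhd_def)
  then have "finite M"
    by (simp add: M_def)
  \<comment> \<open>\<open>M\<close> holds the repeated colors, and \<open>h\<close> numbers them
    from 1 because index 0 is reserved for the remaining neighbors.\<close>
  then obtain h where h: "bij_betw h {1..card M} M"
    using ex_bij_betw_nat_finite_1 by blast
  define A where "A t = (if t = 0 then {x \<in> ?N. c x \<notin> M} else ?cls (h t))" for t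
  have A0: "A 0 = {x \<in> ?N. c x \<notin> M}" and At: "\<And>t. 0 < t \<Longrightarrow> A t = ?cls (h t)"
    by (auto simp: A_def)
  have hM: "h t \<in> M" if "t \<in> {1..card M}" for t
    using h that by (rule bij_betw_apply)
  have hex: "\<exists>t\<in>{1..card M}. h t = l" if "l \<in> M" for l
    using h that by (metis bij_betw_imp_surj_on imageE)
  have hinj: "t = s" if "t \<in> {1..card M}" "s \<in> {1..card M}" "h t = h s" for t s
    using h that by (meson bij_betw_imp_inj_on inj_onD)
  have "weak_partition V E v (card M) A"
    unfolding weak_partition_def
  proof (intro conjI ballI)
    show "(\<Union>t\<le>card M. A t) = ?N"
    proof
      show "(\<Union>t\<le>card M. A t) \<subseteq> ?N"
        by (auto simp: A_def split: if_splits)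
      show "?N \<subseteq> (\<Union>t\<le>card M. A t)"
      proof
        fix x assume x: "x \<in> ?N"
        show "x \<in> (\<Union>t\<le>card M. A t)"
        proof (cases "c x \<in> M")
          case True
          then obtain t where "t \<in> {1..card M}" "h t = c x"
            using hex by blast
          then show ?thesis
            using x At[of t] by (intro UN_I[of t]) auto
        next
          case False
          then show ?thesis
            using x A0 by auto
        qed
      qed
    qed
    show "disjoint_family_on A {..card M}"
      unfolding disjoint_family_on_def
    proof (intro ballI impI)
      fix t s assume ts: "t \<in> {..card M}" "s \<in> {..card M}" "t \<noteq> s"
      show "A t \<inter> A s = {}"
      proof (cases "t = 0 \<or> s = 0")
        case True
        then show ?thesis
          using ts hM[of t] hM[of s] by (auto simp: A_def)
      next
        case False
        then show ?thesis
          using ts hinj[of t s] by (auto simp: A_def)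
      qed
    qed
    show "2 \<le> card (A t)" if "t \<in> {1..card M}" for t
      using hM[OF that] that by (simp add: A_def M_def)
  qed
  moreover have "card (A 0) + card M = card (c ` ?N)"
  proof -
    \<comment> \<open>Two neighbors of equal color would make that color repeated and so keep both
      out of \<open>A 0\<close>.\<close>
    have "inj_on c (A 0)"
    proof (rule inj_onI)
      fix x y assume xy: "x \<in> A 0" "y \<in> A 0" "c x = c y"
      then have "{x, y} \<subseteq> ?cls (c x)"
        by (auto simp: A0)
      then have "card {x, y} \<le> card (?cls (c x))"
        using finN by (intro card_mono) auto
      then show "x = y"
        using xy by (cases "x = y") (auto simp: A0 M_def)
    qed
    then have "card (A 0) = card (c ` A 0)"
      by (simp add: card_image)
    moreover have "c ` ?N = c ` A 0 \<union> M" "c ` A 0 \<inter> M = {}"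
      by (auto simp: A0 M_def)
    ultimately show ?thesis
      using \<open>finite M\<close> finN by (simp add: card_Un_disjoint A0)
  qed
  moreover have "\<exists>t\<in>{1..card M}. x \<in> A t \<and> y \<in> A t"
    if xy: "x \<in> ?N" "y \<in> ?N" "x \<noteq> y" "c x = c y" for x y
  proof -
    have "{x, y} \<subseteq> ?cls (c x)"
      using xy by auto
    then have "card {x, y} \<le> card (?cls (c x))"
      using finN by (intro card_mono) auto
    then have "c x \<in> M"
      using xy by (auto simp: M_def)
    then obtain t where "t \<in> {1..card M}" "h t = c x"
      using hex by blast
    then show ?thesis
      using xy At[of t] by (intro bexI[of _ t]) auto
  qed
  ultimately show thesis
    by (rule that)
qed

section \<open>Blocked colors and the paths they produce\<close>

text \<open>Since \<open>c\<close> itself has no bicolored cycle, the cycle passes through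
  \<open>v\<close>, and its remainder is a path between two neighbors of \<open>v\<close>. Neither
  end has color \<open>j\<close>, so alternation gives both ends the other color and puts
  \<open>j\<close> at the odd indices.\<close>

lemma blocked_color_path:
  assumes acy: "acyclic_coloring V E C c"
    and free: "j \<notin> c ` nbhd V E v"
    and cyc: "is_cycle V E xs" "(c(v := j)) ` set xs \<subseteq> {a, b}"
  obtains ys where "is_path V E ys" "v \<notin> set ys" "odd (length ys)" "hd ys \<noteq> last ys"
    "hd ys \<in> nbhd V E v" "last ys \<in> nbhd V E v" "c (hd ys) = c (last ys)"
    "1 < length ys" "\<And>n. n < length ys \<Longrightarrow> odd n \<Longrightarrow> c (ys ! n) = j"
proof -
  have "v \<in> set xs"
  proof (rule ccontr)
    assume "v \<notin> set xs"
    then have "(c(v := j)) ` set xs = c ` set xs"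
      by (intro image_cong) auto
    then show False
      using acy cyc by (metis acyclic_coloring_iff)
  qed
  then obtain ys where ys: "is_cycle V E (v # ys)" "set (v # ys) = set xs"
    using is_cycle_rotate[OF cyc(1)] by blast
  have dist: "distinct ys" "v \<notin> set ys" and len: "1 < length ys"
    using ys(1) by (auto simp: is_cycle_def is_path_def)
  then have ne: "ys \<noteq> []"
    by auto
  have path: "is_path V E ys"
    using ys(1) ne by (auto simp: is_cycle_def is_path_def successively_Cons)
  have ends: "hd ys \<in> nbhd V E v" "last ys \<in> nbhd V E v"
    using ys(1) ne hd_in_set[OF ne] last_in_set[OF ne]
    by (auto simp: is_cycle_def is_path_def successively_Cons nbhd_def insert_commute)
  define l where "l = c (hd ys)"
  have img: "(c(v := j)) ` set ys = c ` set ys"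
    using dist by (intro image_cong) auto
  \<comment> \<open>Since \<open>v\<close> now has color \<open>j\<close>, both \<open>j\<close> and
    the different color \<open>l\<close> lie in \<open>{a, b}\<close>; hence these are the only two
    colors on the cycle.\<close>
  have "insert j (c ` set ys) \<subseteq> {a, b}"
    using cyc(2) img unfolding ys(2)[symmetric] by auto
  have "l \<noteq> j" "l \<in> c ` set ys"
    using ends free hd_in_set[OF ne] by (auto simp: l_def)
  then have "c ` set ys \<subseteq> {j, l}"
    using \<open>insert j (c ` set ys) \<subseteq> {a, b}\<close> by auto
  moreover have "proper_coloring V E C c"
    using acy by (simp add: acyclic_coloring_def)
  ultimately have alt: "c (ys ! n) = (if even n then l else j)" if "n < length ys" for n
    using two_colored_path_alternates[OF path] that l_def by metis
  have "c (last ys) \<noteq> j"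
    using ends free by auto
  moreover have last: "last ys = ys ! (length ys - 1)" "length ys - 1 < length ys"
    using ne by (auto simp: last_conv_nth)
  ultimately have "even (length ys - 1)"
    using alt[OF last(2)] by (auto split: if_splits)
  then have odd: "odd (length ys)" and "c (last ys) = l"
    using len alt[OF last(2)] last by auto
  moreover have "hd ys \<noteq> last ys"
    using dist(1) len ne by (simp add: hd_conv_nth last_conv_nth nth_eq_iff_index_eq)
  ultimately show thesis
    using that[of ys] path dist ends len alt by (simp add: l_def)
qed

text \<open>The colors of \<open>C\<close> are covered by the color of \<open>v\<close>, those of
  its neighbors, and the blocked set \<open>J\<close>. The last two groups are counted by the
  partition and by the paths, so only the color of \<open>v\<close> is lost. \<open>C\<close> and
  \<open>D\<close> are kept apart because a partially recolored graph need not use all of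
  \<open>C\<close>.\<close>

lemma acyclic_degree_ge_if_all_blocked:
  assumes fin: "finite V" "finite C"
    and acy: "acyclic_coloring V E D c"
    and blocked: "\<And>j. j \<in> C - c ` insert v (nbhd V E v) \<Longrightarrow>
      \<exists>xs a b. is_cycle V E xs \<and> (c(v := j)) ` set xs \<subseteq> {a, b}"
  shows "card C - 1 \<le> acyclic_degree V E v"
proof -
  let ?N = "nbhd V E v"
  define J where "J = C - c ` insert v ?N"
  define P where "P j ys \<longleftrightarrow> is_path V E ys \<and> v \<notin> set ys \<and> odd (length ys) \<and>
    hd ys \<noteq> last ys \<and> hd ys \<in> ?N \<and> last ys \<in> ?N \<and> c (hd ys) = c (last ys) \<and>
    1 < length ys \<and> (\<forall>n<length ys. odd n \<longrightarrow> c (ys ! n) = j)" for j ys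
  have "\<exists>ys. P j ys" if j: "j \<in> J" for j
  proof -
    obtain xs a b where "is_cycle V E xs" "(c(v := j)) ` set xs \<subseteq> {a, b}"
      using blocked j unfolding J_def by blast
    moreover have "j \<notin> c ` ?N"
      using j by (auto simp: J_def)
    ultimately show ?thesis
      using blocked_color_path[OF acy, of j v xs a b] unfolding P_def by metis
  qed
  then obtain p where p: "\<And>j. j \<in> J \<Longrightarrow> P j (p j)"
    by metis
  obtain k A where part: "weak_partition V E v k A" and cnt: "card (A 0) + k = card (c ` ?N)"
    and same: "\<And>x y. x \<in> ?N \<Longrightarrow> y \<in> ?N \<Longrightarrow> x \<noteq> y \<Longrightarrow> c x = c y \<Longrightarrow>
      \<exists>t\<in>{1..k}. x \<in> A t \<and> y \<in> A t"
    using weak_partition_by_colors[OF fin(1), of E v c] by blast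
  \<comment> \<open>The color of a vertex in an even position identifies the path, which yields EVI
    disjointness.\<close>
  have evencol: "c x = j" if "j \<in> J" "x \<in> even_pos_verts (p j)" for j x
    using p[OF that(1)] that(2) by (auto simp: P_def even_pos_verts_def)
  have "inj_on p J"
  proof (rule inj_onI)
    fix i j assume "i \<in> J" "j \<in> J" "p i = p j"
    \<comment> \<open>Index 1 exists because the paths have more than one vertex, and its color
      recovers the index of the path.\<close>
    moreover have "c (p i ! 1) = i" "c (p j ! 1) = j"
      using p[OF \<open>i \<in> J\<close>] p[OF \<open>j \<in> J\<close>] by (auto simp: P_def)
    ultimately show "i = j"
      by simp
  qed
  then have cardF: "card (p ` J) = card J"
    by (rule card_image)
  have "card (A 0) + k + card (p ` J) \<le> acyclic_degree V E v"
  proof (rule acyclic_degree_ge[OF fin(1) part])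
    show "elp_path V E v k A xs" if "xs \<in> p ` J" for xs
      using that p same by (auto simp: elp_path_def P_def)
    show "EVI_disjoint (p ` J)"
      unfolding EVI_disjoint_def disjoint_family_on_def
    proof (intro ballI impI)
      fix xs ys assume "xs \<in> p ` J" "ys \<in> p ` J" "xs \<noteq> ys"
      then obtain i j where "i \<in> J" "j \<in> J" "xs = p i" "ys = p j" "i \<noteq> j"
        by blast
      then show "even_pos_verts xs \<inter> even_pos_verts ys = {}"
        using evencol by blast
    qed
  qed
  moreover have "card C \<le> card (insert (c v) (c ` ?N) \<union> J)"
    using fin by (intro card_mono) (auto simp: J_def nbhd_def)
  moreover have "\<dots> \<le> card (insert (c v) (c ` ?N)) + card J"
    by (rule card_Un_le)
  moreover have "card (insert (c v) (c ` ?N)) \<le> Suc (card (c ` ?N))"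
    by (rule card_insert_le_m1) auto
  ultimately show ?thesis
    using cnt cardF by linarith
qed

section \<open>Recoloring a whole color class\<close>

text \<open>If every vertex of the class has small degree, each has a color that is not blocked.
  Recoloring one vertex after another with such a color, always relative to the current coloring,
  ends in an acyclic recoloring step.\<close>

lemma color_class_has_large_acyclic_degree:
  assumes fin: "finite V" and C: "finite C" "i \<in> C"
    and acy: "acyclic_coloring V E C c"
    and stuck: "\<nexists>c'. acyclic_recoloring_step V E C c i c'"
  shows "\<exists>v\<in>color_class V c i. card C - 1 \<le> acyclic_degree V E v"
proof (rule ccontr)
  assume small: "\<not> ?thesis"
  let ?I = "color_class V c i"
  let ?free = "\<lambda>v. C - c ` insert v (nbhd V E v)"
  have proper: "c u \<noteq> c w" if "{u, w} \<in> E" "u \<in> V" "w \<in> V" for u w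
    using acy that by (auto simp: acyclic_coloring_def proper_coloring_def)
  have cV: "c ` V = C"
    using acy by (auto simp: acyclic_coloring_def proper_coloring_def)
  \<comment> \<open>\<open>R S c'\<close> says that exactly the vertices of \<open>S\<close> have
    been treated, each with a color free in the original coloring \<open>c\<close>, as a recoloring
    step demands.\<close>
  define R where "R S c' \<longleftrightarrow> (\<forall>v\<in>S. c' v \<in> ?free v) \<and> (\<forall>v\<in>V - S. c' v = c v)" for S c'
  have Rproper: "proper_coloring V E (c' ` V) c'" if R: "R S c'" and S: "S \<subseteq> ?I" for S c'
    unfolding proper_coloring_def
  proof (intro conjI ballI impI refl)
    fix u w assume e: "u \<in> V" "w \<in> V" "{u, w} \<in> E"
    \<comment> \<open>A color class is independent, so on every edge at most one end has been
      treated, and its new color avoids the old color of the other end.\<close>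
    have "\<not> (u \<in> S \<and> w \<in> S)"
      using proper e S by (auto simp: color_class_def)
    moreover have "u \<in> nbhd V E w" "w \<in> nbhd V E u"
      using e by (auto simp: nbhd_def insert_commute)
    ultimately show "c' u \<noteq> c' w"
      using R e proper unfolding R_def by (cases "u \<in> S"; cases "w \<in> S") force+
  qed
  have "\<exists>c'. R S c' \<and> acyclic_coloring V E (c' ` V) c'"
    if "finite S" "S \<subseteq> ?I" for S
    using that
  proof (induction S rule: finite_induct)
    case empty
    then show ?case
      using acy by (intro exI[of _ c]) (simp add: R_def cV)
  next
    case (insert v S)
    then obtain c' where R: "R S c'" and ac: "acyclic_coloring V E (c' ` V) c'"
      by auto
    have v: "v \<in> V" "c v = i"
      using insert.prems by (auto simp: color_class_def)
    \<comment> \<open>No neighbor of \<open>v\<close> has color \<open>i\<close>, so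
      \<open>v\<close> and its neighbors are still untouched: the colors free at \<open>v\<close>
      are the same for \<open>c'\<close> as for \<open>c\<close>.\<close>
    have "c' x = c x" if "x \<in> insert v (nbhd V E v)" for x
    proof -
      have "x \<notin> S"
        using that insert.hyps insert.prems v proper[of x v] by (auto simp: nbhd_def color_class_def)
      moreover have "x \<in> V"
        using that v by (auto simp: nbhd_def)
      ultimately show ?thesis
        using R by (auto simp: R_def)
    qed
    then have img: "c' ` insert v (nbhd V E v) = c ` insert v (nbhd V E v)"
      by (intro image_cong) auto
    have "\<exists>j\<in>?free v. \<forall>xs a b. is_cycle V E xs \<longrightarrow> \<not> (c'(v := j)) ` set xs \<subseteq> {a, b}"
    proof (rule ccontr)
      assume "\<not> ?thesis"
      then have "card C - 1 \<le> acyclic_degree V E v"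
        unfolding img[symmetric]
        by (intro acyclic_degree_ge_if_all_blocked[OF fin C(1) ac]) blast
      then show False
        using small insert.prems by auto
    qed
    then obtain j where j: "j \<in> ?free v"
      "\<forall>xs a b. is_cycle V E xs \<longrightarrow> \<not> (c'(v := j)) ` set xs \<subseteq> {a, b}"
      by blast
    then have R': "R (insert v S) (c'(v := j))"
      using R by (auto simp: R_def)
    have "acyclic_coloring V E ((c'(v := j)) ` V) (c'(v := j))"
      unfolding acyclic_coloring_iff using Rproper[OF R' insert.prems] j(2) by blast
    then show ?case
      using R' by blast
  qed
  moreover have "finite ?I"
    using fin by (simp add: color_class_def)
  ultimately obtain c' where R: "R ?I c'" and ac: "acyclic_coloring V E (c' ` V) c'"
    by blast
  have free: "c' v \<in> ?free v" if "v \<in> ?I" for v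
    using R that by (auto simp: R_def)
  have same: "c' v = c v" if "v \<in> V" "c v \<noteq> i" for v
    using R that by (auto simp: R_def color_class_def)
  have "recoloring_step V E C c i c'"
    unfolding recoloring_step_def
    using C(2) free R by (auto simp: R_def b_vertex_def)
  \<comment> \<open>A free color lies in \<open>C\<close> and differs from the old color
    \<open>i\<close>, while all other classes keep their vertices.\<close>
  moreover have "c' ` V = C - {i}"
  proof
    show "c' ` V \<subseteq> C - {i}"
    proof
      fix y assume "y \<in> c' ` V"
      then obtain v where v: "v \<in> V" "y = c' v"
        by blast
      then show "y \<in> C - {i}"
        using free[of v] same[of v] cV by (cases "c v = i") (auto simp: color_class_def)
    qed
    show "C - {i} \<subseteq> c' ` V"
    proof
      fix y assume y: "y \<in> C - {i}"
      then obtain v where "v \<in> V" "c v = y"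
        using cV by blast
      then show "y \<in> c' ` V"
        using same[of v] y by force
    qed
  qed
  then have "acyclic_coloring V E (C - {i}) c'"
    using ac by simp
  ultimately show False
    using stuck acy by (auto simp: acyclic_recoloring_step_def)
qed

section \<open>From many vertices of large degree to \<open>m_a\<close>\<close>

text \<open>In a non-increasing ordering, if the vertex at place \<open>card W\<close> had degree
  below \<open>card W - 1\<close>, then so would all later ones, and \<open>W\<close> would have to
  fit into the \<open>card W - 1\<close> earlier places. List indices start at 0, so that vertex is
  \<open>vs ! (card W - 1)\<close>.\<close>

lemma card_le_m_a:
  assumes fin: "finite V" and W: "W \<subseteq> V" "\<And>w. w \<in> W \<Longrightarrow> card W - 1 \<le> acyclic_degree V E w"
  shows "card W \<le> m_a V E"
proof (cases "card W = 0")
  case False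
  let ?d = "acyclic_degree V E"
  obtain us where us: "set us = V" "distinct us"
    using finite_distinct_list[OF fin] by blast
  define vs where "vs = rev (sort_key ?d us)"
  have vs: "distinct vs" "set vs = V"
    using us by (auto simp: vs_def)
  have sorted: "sorted_wrt (\<lambda>u v. ?d v \<le> ?d u) vs"
    using sorted_sort_key[of ?d us] by (simp add: vs_def sorted_wrt_rev sorted_wrt_map)
  let ?k = "card W"
  have len: "?k \<le> length vs"
    using card_mono[OF fin W(1)] vs distinct_card[of vs] by simp
  have "?k - 1 \<le> ?d (vs ! (?k - 1))"
  proof (rule ccontr)
    assume less: "\<not> ?thesis"
    have "W \<subseteq> (!) vs ` {..<?k - 1}"
    proof
      fix w assume w: "w \<in> W"
      then obtain n where n: "n < length vs" "w = vs ! n"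
        using W(1) vs by (metis in_set_conv_nth subsetD)
      have "n < ?k - 1"
      proof (rule ccontr)
        assume "\<not> n < ?k - 1"
        then have "?d w \<le> ?d (vs ! (?k - 1))"
          using n sorted_wrt_nth_less[OF sorted, of "?k - 1" n] by (cases "n = ?k - 1") auto
        then show False
          using less W(2)[OF w] by linarith
      qed
      then show "w \<in> (!) vs ` {..<?k - 1}"
        using n by blast
    qed
    then have "?k \<le> card {..<?k - 1}"
      by (meson finite_lessThan surj_card_le)
    then show False
      using False by simp
  qed
  then show ?thesis
    unfolding m_a_ordering[OF vs sorted] using False len by (intro Max_ge) auto
qed simp

section \<open>Existence of colorings without acyclic recoloring steps, and the final bound\<close>

text \<open>A recoloring step leaves the color set \<open>{1..k} - {i}\<close>; renaming brings it
  back to the form \<open>{1..k - 1}\<close>.\<close>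

lemma acyclic_coloring_rename:
  assumes "acyclic_coloring V E C c" "inj_on f C"
  shows "acyclic_coloring V E (f ` C) (f \<circ> c)"
  unfolding acyclic_coloring_iff
proof (intro conjI allI impI notI)
  have cV: "c ` V = C" and proper: "\<And>u v. {u, v} \<in> E \<Longrightarrow> u \<in> V \<Longrightarrow> v \<in> V \<Longrightarrow> c u \<noteq> c v"
    using assms(1) by (auto simp: acyclic_coloring_def proper_coloring_def)
  show "proper_coloring V E (f ` C) (f \<circ> c)"
    using cV proper inj_onD[OF assms(2)] unfolding proper_coloring_def
    by (metis comp_apply image_comp image_eqI)
  fix xs i j
  assume cyc: "is_cycle V E xs" and ij: "(f \<circ> c) ` set xs \<subseteq> {i, j}"
  have "set xs \<subseteq> V"
    using cyc by (auto simp: is_cycle_def is_path_def)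
  \<comment> \<open>Inverting \<open>f\<close> on \<open>C\<close> pulls the two colors of the cycle
    back to two colors of \<open>c\<close>.\<close>
  then have "c x = inv_into C f (f (c x))" if "x \<in> set xs" for x
    using that cV assms(2) by (auto simp: inv_into_f_f)
  then have "c ` set xs \<subseteq> {inv_into C f i, inv_into C f j}"
    using ij by (smt (verit) comp_apply image_subset_iff insert_iff singletonD)
  then show False
    using assms(1) cyc by (auto simp: acyclic_coloring_iff)
qed

text \<open>Give all vertices different colors: every cycle then carries at least three.\<close>

lemma ex_acyclic_coloring:
  assumes "fin_simple_graph V E"
  shows "\<exists>c. acyclic_coloring V E {1..card V} c"
proof -
  have "finite V"
    using assms by (simp add: fin_simple_graph_def)
  then obtain c where c: "bij_betw c V {1..card V}"
    using bij_betw_inv ex_bij_betw_nat_finite_1 by metis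
  then have inj: "inj_on c V"
    by (rule bij_betw_imp_inj_on)
  have "\<not> c ` set xs \<subseteq> {i, j}" if "is_cycle V E xs" for xs i j
  proof
    assume sub: "c ` set xs \<subseteq> {i, j}"
    have xs: "set xs \<subseteq> V" "distinct xs" "3 \<le> length xs"
      using that by (auto simp: is_cycle_def is_path_def)
    then have "card (c ` set xs) = length xs"
      using inj by (metis card_image distinct_card inj_on_subset)
    moreover have "card (c ` set xs) \<le> card {i, j}"
      using sub by (intro card_mono) auto
    moreover have "card {i, j} \<le> 2"
      by (simp add: card_insert_if)
    ultimately show False
      using xs by linarith
  qed
  moreover have "c u \<noteq> c v" if "{u, v} \<in> E" "u \<in> V" "v \<in> V" for u v
  proof
    assume "c u = c v"
    then have "u = v"
      using inj that by (meson inj_onD)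
    then show False
      using assms that by (auto simp: fin_simple_graph_def)
  qed
  ultimately have "acyclic_coloring V E {1..card V} c"
    using c by (simp add: acyclic_coloring_iff proper_coloring_def bij_betw_def)
  then show ?thesis
    by blast
qed

text \<open>An acyclic coloring with the fewest colors admits no step, as a step would save a color.
  This makes the set under \<open>Max\<close> in \<open>A_b\<close> nonempty.\<close>

lemma ex_stuck_acyclic_coloring:
  assumes "fin_simple_graph V E"
  shows "\<exists>k c. acyclic_coloring V E {1..k} c \<and>
    (\<nexists>i c'. acyclic_recoloring_step V E {1..k} c i c')"
proof -
  define k where "k = (LEAST k. \<exists>c. acyclic_coloring V E {1..k} c)"
  have "\<exists>c. acyclic_coloring V E {1..k} c"
    unfolding k_def using ex_acyclic_coloring[OF assms] by (rule LeastI)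
  then obtain c where c: "acyclic_coloring V E {1..k} c"
    by blast
  have "\<not> acyclic_recoloring_step V E {1..k} c i c'" for i c'
  proof
    assume "acyclic_recoloring_step V E {1..k} c i c'"
    then have c': "acyclic_coloring V E ({1..k} - {i}) c'" and i: "i \<in> {1..k}"
      by (auto simp: acyclic_recoloring_step_def recoloring_step_def)
    have "card ({1..k} - {i}) = card {1..k - 1}"
      using i by simp
    then obtain f where "bij_betw f ({1..k} - {i}) {1..k - 1}"
      using finite_same_card_bij by blast
    then have "acyclic_coloring V E {1..k - 1} (f \<circ> c')"
      using acyclic_coloring_rename[OF c', of f] by (simp add: bij_betw_def)
    then have "k \<le> k - 1"
      unfolding k_def by (intro Least_le) blast
    then show False
      using i by simp
  qed
  then show ?thesis
    using c by blast
qed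

theorem theorem2:
  fixes V :: "'a set" and E :: "'a set set"
  assumes "fin_simple_graph V E"
  shows "A_b V E \<le> m_a V E"
proof -
  have fin: "finite V"
    using assms by (simp add: fin_simple_graph_def)
  let ?S = "{k. \<exists>c. acyclic_coloring V E {1..k} c \<and>
    (\<nexists>i c'. acyclic_recoloring_step V E {1..k} c i c')}"
  have bound: "k \<le> m_a V E" if k: "k \<in> ?S" for k
  proof -
    obtain c where c: "acyclic_coloring V E {1..k} c"
      and stuck: "\<nexists>i c'. acyclic_recoloring_step V E {1..k} c i c'"
      using k by blast
    have "\<exists>v\<in>color_class V c i. k - 1 \<le> acyclic_degree V E v" if "i \<in> {1..k}" for i
      using color_class_has_large_acyclic_degree[OF fin _ that c] stuck by simp
    then obtain w where w: "\<And>i. i \<in> {1..k} \<Longrightarrow> w i \<in> color_class V c i"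
      "\<And>i. i \<in> {1..k} \<Longrightarrow> k - 1 \<le> acyclic_degree V E (w i)"
      by metis
    \<comment> \<open>Representatives of different color classes are distinct, since
      \<open>c\<close> is a left inverse of \<open>w\<close>.\<close>
    have "inj_on w {1..k}"
      by (rule inj_on_inverseI[of _ c]) (use w(1) in \<open>auto simp: color_class_def\<close>)
    then have "card (w ` {1..k}) = k"
      by (simp add: card_image)
    moreover have "w ` {1..k} \<subseteq> V"
      using w(1) by (auto simp: color_class_def)
    moreover have "k - 1 \<le> acyclic_degree V E v" if "v \<in> w ` {1..k}" for v
      using w(2) that by blast
    ultimately show ?thesis
      using card_le_m_a[OF fin, of "w ` {1..k}" E] by metis
  qed
  \<comment> \<open>The bound on the members also supplies the finiteness that makes
    \<open>Max\<close> meaningful.\<close>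
  then have "finite ?S"
    by (intro finite_subset[of ?S "{..m_a V E}"]) auto
  moreover have "?S \<noteq> {}"
    using ex_stuck_acyclic_coloring[OF assms] by blast
  ultimately show ?thesis
    unfolding A_b_def using bound by (intro Max.boundedI)
qed

end
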